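(* Let $H$ and $K$ be two distinct subgroups of a discrete group $G$. Then $$d_{KK}\big(\mathbb{C}[H],\mathbb{C}[K]\big)=d_{KK}\big(\ell^1(H),\ell^1(K)\big)=1$$ in $\ell^1(G)$.
   Context: $\ell^1(G)$ is the unital Banach $*$-algebra of functions $f:G\to\mathbb{C}$ with $\|f\|_1=\sum_g|f(g)|<\infty$, with convolution product $(ab)(g)=\sum_{h}a(h)b(h^{-1}g)$ and involution $a^*(g)=\overline{a(g^{-1})}$. The group algebra $\mathbb{C}[G]$ is identified with the dense $*$-subalgebra of finitely supported functions; for a subgroup $H\le G$, $\mathbb{C}[H]$ and $\ell^1(H)$ are regarded as subalgebras of $\ell^1(G)$ (extension by zero). The Kadison-Kastler distance between subalgebras $C,D$ of a normed algebra is $d_{KK}(C,D)=\max\{\sup_{x\in B_1(C)}d(x,B_1(D)),\sup_{z\in B_1(D)}d(z,B_1(C))\}$, where $B_1(\cdot)$ is the closed unit ball and $d(x,S)=\inf_{y\in S}\|x-y\|$. *)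

theory Defs
  imports "HOL-Algebra.Group" "HOL-Analysis.Infinite_Sum"
begin

text \<open>
  Elements of \<open>\<ell>\<^sup>1(G)\<close> are total functions on the ambient type that vanish off the carrier.
  With this convention \<open>l1 H\<close> and \<open>group_alg H\<close>, for a subgroup \<open>H\<close> of \<open>G\<close>, are literally the
  subsets of \<open>l1 (carrier G)\<close> obtained by extension by zero.
\<close>

definition l1 :: "'a set \<Rightarrow> ('a \<Rightarrow> complex) set" where
  "l1 S = {f. (\<forall>g. g \<notin> S \<longrightarrow> f g = 0) \<and> (\<lambda>g. norm (f g)) summable_on S}"

definition group_alg :: "'a set \<Rightarrow> ('a \<Rightarrow> complex) set" where
  "group_alg S = {f. (\<forall>g. g \<notin> S \<longrightarrow> f g = 0) \<and> finite {g. f g \<noteq> 0}}"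

definition l1_norm :: "('a, 'b) monoid_scheme \<Rightarrow> ('a \<Rightarrow> complex) \<Rightarrow> real" where
  "l1_norm G f = (\<Sum>\<^sub>\<infinity>g\<in>carrier G. norm (f g))"

definition l1_mult ::
  "('a, 'b) monoid_scheme \<Rightarrow> ('a \<Rightarrow> complex) \<Rightarrow> ('a \<Rightarrow> complex) \<Rightarrow> 'a \<Rightarrow> complex" where
  "l1_mult G a b = (\<lambda>g. if g \<in> carrier G
     then \<Sum>\<^sub>\<infinity>h\<in>carrier G. a h * b (inv\<^bsub>G\<^esub> h \<otimes>\<^bsub>G\<^esub> g) else 0)"

definition l1_star :: "('a, 'b) monoid_scheme \<Rightarrow> ('a \<Rightarrow> complex) \<Rightarrow> 'a \<Rightarrow> complex" where
  "l1_star G a = (\<lambda>g. if g \<in> carrier G then cnj (a (inv\<^bsub>G\<^esub> g)) else 0)"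

definition l1_star_subalgebra ::
  "('a, 'b) monoid_scheme \<Rightarrow> ('a \<Rightarrow> complex) set \<Rightarrow> bool" where
  "l1_star_subalgebra G C \<longleftrightarrow>
     C \<subseteq> l1 (carrier G) \<and>
     (\<lambda>g. if g = \<one>\<^bsub>G\<^esub> then 1 else 0) \<in> C \<and>
     (\<forall>a\<in>C. \<forall>b\<in>C. (\<lambda>g. a g + b g) \<in> C) \<and>
     (\<forall>c. \<forall>a\<in>C. (\<lambda>g. c * a g) \<in> C) \<and>
     (\<forall>a\<in>C. \<forall>b\<in>C. l1_mult G a b \<in> C) \<and>
     (\<forall>a\<in>C. l1_star G a \<in> C)"

text \<open>
  The ambient norm is the explicit parameter \<open>N\<close>. For linear subspaces \<open>C\<close> and \<open>D\<close> both closed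
  unit balls contain \<open>0\<close>, so every infimum below is over a nonempty set of nonnegative reals, and
  every supremum over a nonempty subset of \<open>[0, 1]\<close>: the real-valued operators have their usual
  meaning.
\<close>

definition unit_ball :: "('v \<Rightarrow> real) \<Rightarrow> 'v set \<Rightarrow> 'v set" where
  "unit_ball N C = {x \<in> C. N x \<le> 1}"

definition set_dist :: "('v::minus \<Rightarrow> real) \<Rightarrow> 'v \<Rightarrow> 'v set \<Rightarrow> real" where
  "set_dist N x S = (INF y\<in>S. N (x - y))"

definition kk_dist :: "('v::minus \<Rightarrow> real) \<Rightarrow> 'v set \<Rightarrow> 'v set \<Rightarrow> real" where
  "kk_dist N C D =
     max (SUP x\<in>unit_ball N C. set_dist N x (unit_ball N D))
         (SUP z\<in>unit_ball N D. set_dist N z (unit_ball N C))"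

lemma l1_summable_mono:
  assumes "f \<in> l1 S" "S \<subseteq> T"
  shows "(\<lambda>g. norm (f g)) summable_on T"
proof -
  have "(\<lambda>g. norm (f g)) summable_on S \<longleftrightarrow> (\<lambda>g. norm (f g)) summable_on T"
    by (rule summable_on_cong_neutral) (use assms in \<open>auto simp: l1_def\<close>)
  then show ?thesis using assms(1) by (simp add: l1_def)
qed

lemma l1_mono: "S \<subseteq> T \<Longrightarrow> l1 S \<subseteq> l1 T"
proof
  fix f assume "S \<subseteq> T" "f \<in> l1 S"
  then show "f \<in> l1 T"
    using l1_summable_mono[of f S T] by (auto simp: l1_def)
qed

lemma group_alg_subset_l1: "group_alg S \<subseteq> l1 S"
proof
  fix f assume f: "f \<in> group_alg S"
  have "(\<lambda>g. norm (f g)) summable_on S \<longleftrightarrow> (\<lambda>g. norm (f g)) summable_on {g. f g \<noteq> 0}"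
    by (rule summable_on_cong_neutral) (use f in \<open>auto simp: group_alg_def\<close>)
  then show "f \<in> l1 S"
    using f by (auto simp: group_alg_def l1_def)
qed

lemma l1_mult_eq_0:
  assumes "group G" "subgroup H G"
    and "\<And>g. g \<notin> H \<Longrightarrow> a g = 0" "\<And>g. g \<notin> H \<Longrightarrow> b g = 0" "g \<notin> H"
  shows "l1_mult G a b g = 0"
proof (cases "g \<in> carrier G")
  case True
  interpret group G by fact
  have "a h * b (inv\<^bsub>G\<^esub> h \<otimes>\<^bsub>G\<^esub> g) = 0" for h
  proof (rule ccontr)
    assume "a h * b (inv\<^bsub>G\<^esub> h \<otimes>\<^bsub>G\<^esub> g) \<noteq> 0"
    then have hH: "h \<in> H" and kH: "inv\<^bsub>G\<^esub> h \<otimes>\<^bsub>G\<^esub> g \<in> H"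
      using assms(3,4) by force+
    have hG: "h \<in> carrier G" using hH assms(2) subgroup.mem_carrier by fast
    have "h \<otimes>\<^bsub>G\<^esub> (inv\<^bsub>G\<^esub> h \<otimes>\<^bsub>G\<^esub> g) \<in> H"
      by (rule subgroup.m_closed[OF assms(2) hH kH])
    also have "h \<otimes>\<^bsub>G\<^esub> (inv\<^bsub>G\<^esub> h \<otimes>\<^bsub>G\<^esub> g) = g"
      using hG True by (simp add: m_assoc[symmetric])
    finally show False using assms(5) by simp
  qed
  then have "(\<Sum>\<^sub>\<infinity>h\<in>carrier G. a h * b (inv\<^bsub>G\<^esub> h \<otimes>\<^bsub>G\<^esub> g)) = 0"
    by (rule infsum_0)
  then show ?thesis by (simp add: l1_mult_def)
qed (simp add: l1_mult_def)

lemma l1_mult_closed: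
  assumes "group G" "subgroup H G" "a \<in> l1 H" "b \<in> l1 H"
  shows "l1_mult G a b \<in> l1 H"
proof -
  interpret group G by fact
  let ?T = "carrier G"
  have HT: "H \<subseteq> ?T" by (rule subgroup.subset[OF assms(2)])
  have sa: "(\<lambda>g. norm (a g)) summable_on ?T" and sb: "(\<lambda>g. norm (b g)) summable_on ?T"
    using l1_summable_mono[OF _ HT] assms(3,4) by auto
  let ?F = "\<lambda>(h, k). a h * b k"
  have "?F abs_summable_on ?T \<times> ?T"
    unfolding abs_summable_on_Sigma_iff
    using sa sb
    by (simp add: norm_mult infsum_cmult_right' summable_on_cmult_right summable_on_cmult_left
        abs_mult infsum_nonneg)
  moreover have "bij_betw (\<lambda>(g, h). (h, inv\<^bsub>G\<^esub> h \<otimes>\<^bsub>G\<^esub> g)) (?T \<times> ?T) (?T \<times> ?T)"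
  proof (rule bij_betw_byWitness[where f' = "\<lambda>(h, k). (h \<otimes>\<^bsub>G\<^esub> k, h)"])
    have "h \<otimes>\<^bsub>G\<^esub> (inv\<^bsub>G\<^esub> h \<otimes>\<^bsub>G\<^esub> g) = g" "inv\<^bsub>G\<^esub> h \<otimes>\<^bsub>G\<^esub> (h \<otimes>\<^bsub>G\<^esub> g) = g"
      if "h \<in> ?T" "g \<in> ?T" for g h
      using that by (simp_all add: m_assoc[symmetric])
    then show "\<forall>x\<in>?T \<times> ?T. (case case x of (g, h) \<Rightarrow> (h, inv\<^bsub>G\<^esub> h \<otimes>\<^bsub>G\<^esub> g) of (h, k) \<Rightarrow> (h \<otimes>\<^bsub>G\<^esub> k, h)) = x"
      and "\<forall>x\<in>?T \<times> ?T. (case case x of (h, k) \<Rightarrow> (h \<otimes>\<^bsub>G\<^esub> k, h) of (g, h) \<Rightarrow> (h, inv\<^bsub>G\<^esub> h \<otimes>\<^bsub>G\<^esub> g)) = x"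
      by auto
  qed auto
  ultimately have "(\<lambda>x. norm (?F ((\<lambda>(g, h). (h, inv\<^bsub>G\<^esub> h \<otimes>\<^bsub>G\<^esub> g)) x))) summable_on ?T \<times> ?T"
    by (subst summable_on_reindex_bij_betw)
  then have "(\<lambda>(g, h). a h * b (inv\<^bsub>G\<^esub> h \<otimes>\<^bsub>G\<^esub> g)) abs_summable_on ?T \<times> ?T"
    by (simp add: case_prod_unfold)
  then have 1: "\<forall>g\<in>?T. (\<lambda>h. a h * b (inv\<^bsub>G\<^esub> h \<otimes>\<^bsub>G\<^esub> g)) abs_summable_on ?T"
    and 2: "(\<lambda>g. \<Sum>\<^sub>\<infinity>h\<in>?T. norm (a h * b (inv\<^bsub>G\<^esub> h \<otimes>\<^bsub>G\<^esub> g))) abs_summable_on ?T"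
    unfolding abs_summable_on_Sigma_iff by auto
  have "l1_mult G a b abs_summable_on ?T"
  proof (rule abs_summable_on_comparison_test[OF 2])
    fix g assume g: "g \<in> ?T"
    have "norm (l1_mult G a b g) \<le> (\<Sum>\<^sub>\<infinity>h\<in>?T. norm (a h * b (inv\<^bsub>G\<^esub> h \<otimes>\<^bsub>G\<^esub> g)))"
      using norm_infsum_bound[OF bspec[OF 1 g]] g by (simp add: l1_mult_def)
    then show "norm (l1_mult G a b g) \<le> norm (\<Sum>\<^sub>\<infinity>h\<in>?T. norm (a h * b (inv\<^bsub>G\<^esub> h \<otimes>\<^bsub>G\<^esub> g)))"
      by simp
  qed
  then have "l1_mult G a b abs_summable_on H"
    using HT summable_on_subset_banach by blast
  moreover have "l1_mult G a b g = 0" if "g \<notin> H" for g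
    by (rule l1_mult_eq_0[OF assms(1,2)]) (use that assms(3,4) in \<open>auto simp: l1_def\<close>)
  ultimately show ?thesis by (simp add: l1_def)
qed

lemma l1_star_eq_0:
  assumes "group G" "subgroup H G" "\<And>g. g \<notin> H \<Longrightarrow> a g = 0" "g \<notin> H"
  shows "l1_star G a g = 0"
proof (cases "g \<in> carrier G")
  case True
  then have "inv\<^bsub>G\<^esub> g \<notin> H"
    using assms subgroup.m_inv_closed[OF assms(2), of "inv\<^bsub>G\<^esub> g"] group.inv_inv[OF assms(1)] by auto
  then show ?thesis using assms(3) by (simp add: l1_star_def)
qed (simp add: l1_star_def)

lemma l1_star_closed:
  assumes "group G" "subgroup H G" "a \<in> l1 H"
  shows "l1_star G a \<in> l1 H"
proof -
  interpret group G by fact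
  have HT: "H \<subseteq> carrier G" by (rule subgroup.subset[OF assms(2)])
  have "bij_betw (\<lambda>g. inv\<^bsub>G\<^esub> g) H H"
    by (rule bij_betw_byWitness[where f' = "\<lambda>g. inv\<^bsub>G\<^esub> g"])
       (use HT subgroup.m_inv_closed[OF assms(2)] in auto)
  then have "(\<lambda>g. norm (a (inv\<^bsub>G\<^esub> g))) summable_on H"
    using assms(3) by (subst summable_on_reindex_bij_betw) (auto simp: l1_def)
  moreover have "norm (l1_star G a g) = norm (a (inv\<^bsub>G\<^esub> g))" if "g \<in> H" for g
    using that HT by (auto simp: l1_star_def)
  ultimately have "(\<lambda>g. norm (l1_star G a g)) summable_on H"
    by (simp cong: summable_on_cong)
  moreover have "l1_star G a g = 0" if "g \<notin> H" for g
    by (rule l1_star_eq_0[OF assms(1,2)]) (use that assms(3) in \<open>auto simp: l1_def\<close>)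
  ultimately show ?thesis by (simp add: l1_def)
qed

lemma l1_star_subalgebra_group_alg:
  assumes "group G" "subgroup H G"
  shows "l1_star_subalgebra G (group_alg H)"
proof -
  interpret group G by fact
  have HT: "H \<subseteq> carrier G" by (rule subgroup.subset[OF assms(2)])
  have mult: "l1_mult G a b \<in> group_alg H" if ab: "a \<in> group_alg H" "b \<in> group_alg H" for a b
  proof -
    have "{g. l1_mult G a b g \<noteq> 0} \<subseteq> (\<lambda>(h, k). h \<otimes>\<^bsub>G\<^esub> k) ` ({g. a g \<noteq> 0} \<times> {g. b g \<noteq> 0})"
    proof
      fix g assume "g \<in> {g. l1_mult G a b g \<noteq> 0}"
      then have g: "g \<in> carrier G" and ne: "(\<Sum>\<^sub>\<infinity>h\<in>carrier G. a h * b (inv\<^bsub>G\<^esub> h \<otimes>\<^bsub>G\<^esub> g)) \<noteq> 0"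
        by (auto simp: l1_mult_def split: if_splits)
      have "\<exists>h\<in>carrier G. a h * b (inv\<^bsub>G\<^esub> h \<otimes>\<^bsub>G\<^esub> g) \<noteq> 0"
      proof (rule ccontr)
        assume "\<not> ?thesis"
        then have "(\<Sum>\<^sub>\<infinity>h\<in>carrier G. a h * b (inv\<^bsub>G\<^esub> h \<otimes>\<^bsub>G\<^esub> g)) = 0"
          by (intro infsum_0) blast
        with ne show False by contradiction
      qed
      then obtain h where h: "h \<in> carrier G" "a h \<noteq> 0" "b (inv\<^bsub>G\<^esub> h \<otimes>\<^bsub>G\<^esub> g) \<noteq> 0"
        by auto
      have "g = h \<otimes>\<^bsub>G\<^esub> (inv\<^bsub>G\<^esub> h \<otimes>\<^bsub>G\<^esub> g)"
        using g h(1) by (simp add: m_assoc[symmetric])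
      then show "g \<in> (\<lambda>(h, k). h \<otimes>\<^bsub>G\<^esub> k) ` ({g. a g \<noteq> 0} \<times> {g. b g \<noteq> 0})"
        using h by (intro image_eqI[where x = "(h, inv\<^bsub>G\<^esub> h \<otimes>\<^bsub>G\<^esub> g)"]) auto
    qed
    then have "finite {g. l1_mult G a b g \<noteq> 0}"
      by (rule finite_subset) (use ab in \<open>auto simp: group_alg_def\<close>)
    moreover have "l1_mult G a b g = 0" if "g \<notin> H" for g
      by (rule l1_mult_eq_0[OF assms]) (use that ab in \<open>auto simp: group_alg_def\<close>)
    ultimately show ?thesis by (simp add: group_alg_def)
  qed
  have star: "l1_star G a \<in> group_alg H" if a: "a \<in> group_alg H" for a
  proof -
    have "{g. l1_star G a g \<noteq> 0} \<subseteq> (\<lambda>g. inv\<^bsub>G\<^esub> g) ` {g. a g \<noteq> 0}"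
    proof
      fix g assume "g \<in> {g. l1_star G a g \<noteq> 0}"
      then have "g \<in> carrier G" "a (inv\<^bsub>G\<^esub> g) \<noteq> 0"
        by (auto simp: l1_star_def split: if_splits)
      then show "g \<in> (\<lambda>g. inv\<^bsub>G\<^esub> g) ` {g. a g \<noteq> 0}"
        by (intro image_eqI[where x = "inv\<^bsub>G\<^esub> g"]) auto
    qed
    then have "finite {g. l1_star G a g \<noteq> 0}"
      by (rule finite_subset) (use a in \<open>auto simp: group_alg_def\<close>)
    moreover have "l1_star G a g = 0" if "g \<notin> H" for g
      by (rule l1_star_eq_0[OF assms]) (use that a in \<open>auto simp: group_alg_def\<close>)
    ultimately show ?thesis by (simp add: group_alg_def)
  qed
  have add: "(\<lambda>g. a g + b g) \<in> group_alg H" if "a \<in> group_alg H" "b \<in> group_alg H" for a b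
  proof -
    have "finite {g. a g + b g \<noteq> 0}"
      by (rule finite_subset[of _ "{g. a g \<noteq> 0} \<union> {g. b g \<noteq> 0}"])
         (use that in \<open>auto simp: group_alg_def\<close>)
    then show ?thesis using that by (simp add: group_alg_def)
  qed
  have "group_alg H \<subseteq> l1 (carrier G)"
    using group_alg_subset_l1 l1_mono[OF HT] by blast
  moreover have "(\<lambda>g. if g = \<one>\<^bsub>G\<^esub> then 1 else 0) \<in> group_alg H"
    using subgroup.one_closed[OF assms(2)] by (auto simp: group_alg_def)
  moreover have "(\<lambda>g. c * a g) \<in> group_alg H" if "a \<in> group_alg H" for a c
    using that by (auto simp: group_alg_def)
  ultimately show ?thesis
    using mult star add by (simp add: l1_star_subalgebra_def)
qed

lemma l1_star_subalgebra_l1: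
  assumes "group G" "subgroup H G"
  shows "l1_star_subalgebra G (l1 H)"
proof -
  have HT: "H \<subseteq> carrier G" by (rule subgroup.subset[OF assms(2)])
  have "(\<lambda>g. a g + b g) \<in> l1 H" if "a \<in> l1 H" "b \<in> l1 H" for a b
  proof -
    have "(\<lambda>g. norm (a g + b g)) summable_on H"
      by (rule abs_summable_on_comparison_test'[of "\<lambda>g. norm (a g) + norm (b g)"])
         (use that in \<open>auto simp: l1_def norm_triangle_ineq intro!: summable_on_add\<close>)
    then show ?thesis using that by (simp add: l1_def)
  qed
  moreover have "(\<lambda>g. c * a g) \<in> l1 H" if "a \<in> l1 H" for a c
    using that by (auto simp: l1_def norm_mult intro!: summable_on_cmult_right)
  moreover have "(\<lambda>g. if g = \<one>\<^bsub>G\<^esub> then 1 else 0) \<in> l1 H"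
    using l1_star_subalgebra_group_alg[OF assms] group_alg_subset_l1
    by (auto simp: l1_star_subalgebra_def)
  ultimately show ?thesis
    using l1_mult_closed[OF assms] l1_star_closed[OF assms] l1_mono[OF HT]
    by (simp add: l1_star_subalgebra_def)
qed

end

theory Submission
  imports Defs
begin

text \<open>
  Every point of one unit ball lies within distance \<open>1\<close> of \<open>0\<close>, which belongs to the other one.
  Conversely, if \<open>g \<in> H - K\<close>, then every function supported on \<open>K\<close> vanishes at \<open>g\<close>, so that
  evaluation at \<open>g\<close> shows that the point mass at \<open>g\<close> has distance at least \<open>1\<close> from it.
\<close>

definition point_mass :: "'a \<Rightarrow> 'a \<Rightarrow> complex" where
  "point_mass g = (\<lambda>h. if h = g then 1 else 0)"

lemma zero_in_group_alg: "(\<lambda>_. 0) \<in> group_alg S"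
  by (simp add: group_alg_def)

lemma point_mass_in_group_alg: "g \<in> S \<Longrightarrow> point_mass g \<in> group_alg S"
  by (auto simp: group_alg_def point_mass_def)

lemma l1_norm_nonneg: "0 \<le> l1_norm G f"
  by (simp add: l1_norm_def infsum_nonneg)

lemma l1_norm_zero: "l1_norm G (\<lambda>_. 0) = 0"
  by (simp add: l1_norm_def)

lemma l1_norm_point_mass:
  assumes "g \<in> carrier G"
  shows "l1_norm G (point_mass g) = 1"
proof -
  have "l1_norm G (point_mass g) = (\<Sum>\<^sub>\<infinity>h\<in>{g}. norm (point_mass g h))"
    unfolding l1_norm_def
    by (rule infsum_cong_neutral) (use assms in \<open>auto simp: point_mass_def\<close>)
  then show ?thesis
    by (simp add: point_mass_def)
qed

lemma l1_diff:
  assumes "a \<in> l1 S" "b \<in> l1 S"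
  shows "a - b \<in> l1 S"
proof -
  have "(\<lambda>g. norm (a g - b g)) summable_on S"
    by (rule abs_summable_on_comparison_test'[of "\<lambda>g. norm (a g) + norm (b g)"])
       (use assms in \<open>auto simp: l1_def norm_triangle_ineq4 intro!: summable_on_add\<close>)
  then show ?thesis
    using assms by (simp add: l1_def)
qed

text \<open>This makes evaluation at a point contractive: one term of a convergent sum of
  nonnegative reals is at most the whole sum, and off the carrier \<open>f\<close> vanishes.\<close>

lemma norm_le_l1_norm:
  assumes "f \<in> l1 (carrier G)"
  shows "norm (f g) \<le> l1_norm G f"
proof (cases "g \<in> carrier G")
  case True
  have "(\<Sum>h\<in>{g}. norm (f h)) \<le> (\<Sum>\<^sub>\<infinity>h\<in>carrier G. norm (f h))"
    by (rule finite_sum_le_infsum) (use assms True in \<open>auto simp: l1_def\<close>)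
  then show ?thesis
    by (simp add: l1_norm_def)
next
  case False
  then show ?thesis
    using assms l1_norm_nonneg[of G f] by (simp add: l1_def)
qed

lemma kk_dist_commute: "kk_dist N C D = kk_dist N D C"
  by (simp add: kk_dist_def max.commute)

lemma set_dist_unit_ball_le_1:
  assumes "(\<lambda>_. 0) \<in> D" "l1_norm G x \<le> 1"
  shows "set_dist (l1_norm G) x (unit_ball (l1_norm G) D) \<le> 1"
proof -
  have zero: "(\<lambda>_. 0) \<in> unit_ball (l1_norm G) D"
    using assms(1) by (simp add: unit_ball_def l1_norm_zero)
  \<comment> \<open>The infimum is compared with the value at the zero function; nonnegativity of
    the norm supplies the lower bound that a real infimum requires.\<close>
  have "set_dist (l1_norm G) x (unit_ball (l1_norm G) D) \<le> l1_norm G (x - (\<lambda>_. 0))"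
    unfolding set_dist_def
    by (rule cINF_lower[OF _ zero]) (auto intro: bdd_belowI2[where m = 0] l1_norm_nonneg)
  also have "x - (\<lambda>_. 0) = x"
    by (simp add: fun_eq_iff)
  finally show ?thesis
    using assms(2) by simp
qed

text \<open>A witness on one side is enough: the distance is a maximum, so one supremum that is at
  least 1 fixes its value once both suprema are at most 1.\<close>

lemma kk_dist_eq_1_if_point_outside:
  assumes "T \<subseteq> carrier G" "g \<in> carrier G" "g \<notin> T"
    and "point_mass g \<in> C" "(\<lambda>_. 0) \<in> C" "(\<lambda>_. 0) \<in> D" "D \<subseteq> l1 T"
  shows "kk_dist (l1_norm G) C D = 1"
proof -
  let ?N = "l1_norm G"
  let ?B = "unit_ball ?N"
  have sup_le: "(SUP x\<in>?B X. set_dist ?N x (?B Y)) \<le> 1"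
    if "(\<lambda>_. 0) \<in> X" "(\<lambda>_. 0) \<in> Y" for X Y
  proof (rule cSUP_least)
    show "?B X \<noteq> {}"
      using that(1) by (auto simp: unit_ball_def l1_norm_zero)
  next
    fix x assume "x \<in> ?B X"
    then show "set_dist ?N x (?B Y) \<le> 1"
      using that(2) by (intro set_dist_unit_ball_le_1) (simp_all add: unit_ball_def)
  qed
  have "1 \<le> set_dist ?N (point_mass g) (?B D)"
    unfolding set_dist_def
  proof (rule cINF_greatest)
    show "?B D \<noteq> {}"
      using assms(6) by (auto simp: unit_ball_def l1_norm_zero)
  next
    fix y assume "y \<in> ?B D"
    then have y: "y \<in> l1 T"
      using assms(7) by (auto simp: unit_ball_def)
    have "point_mass g - y \<in> l1 (carrier G)"
      using l1_diff y l1_mono[OF assms(1)] point_mass_in_group_alg[OF assms(2)] group_alg_subset_l1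
      by blast
    from norm_le_l1_norm[OF this, of g] show "1 \<le> ?N (point_mass g - y)"
      using y assms(3) by (simp add: l1_def point_mass_def)
  qed
  also have "\<dots> \<le> (SUP x\<in>?B C. set_dist ?N x (?B D))"
  proof (rule cSUP_upper)
    show "point_mass g \<in> ?B C"
      using assms(2,4) by (simp add: unit_ball_def l1_norm_point_mass)
    \<comment> \<open>A real supremum dominates its members only for a set bounded above; the bound
      1 comes from comparison with zero.\<close>
    show "bdd_above ((\<lambda>x. set_dist ?N x (?B D)) ` ?B C)"
      using set_dist_unit_ball_le_1[OF assms(6)]
      by (auto intro!: bdd_aboveI2[where M = 1] simp: unit_ball_def)
  qed
  finally show ?thesis
    using sup_le[OF assms(5,6)] sup_le[OF assms(6,5)] by (simp add: kk_dist_def)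
qed

text \<open>The sandwich treats group algebras and their completions together: the lower inclusions
  supply zero and the point masses, the upper ones force vanishing off \<open>S\<close> or
  \<open>T\<close>.\<close>

lemma kk_dist_eq_1:
  assumes "S \<subseteq> carrier G" "T \<subseteq> carrier G" "S \<noteq> T"
    and "group_alg S \<subseteq> C" "C \<subseteq> l1 S" "group_alg T \<subseteq> D" "D \<subseteq> l1 T"
  shows "kk_dist (l1_norm G) C D = 1"
proof -
  have zero: "(\<lambda>_. 0) \<in> C" "(\<lambda>_. 0) \<in> D"
    using assms(4,6) zero_in_group_alg by blast+
  \<comment> \<open>One set may contain the other, so the separating point can lie on either side;
    symmetry of the distance settles the second case.\<close>
  consider g where "g \<in> S" "g \<notin> T" | g where "g \<in> T" "g \<notin> S"
    using assms(3) by blast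
  then show ?thesis
  proof cases
    case 1
    show ?thesis
      by (rule kk_dist_eq_1_if_point_outside[OF assms(2) _ 1(2) _ zero assms(7)])
         (use 1 assms(1) subsetD[OF assms(4) point_mass_in_group_alg] in auto)
  next
    case 2
    have "kk_dist (l1_norm G) D C = 1"
      by (rule kk_dist_eq_1_if_point_outside[OF assms(1) _ 2(2) _ zero(2,1) assms(5)])
         (use 2 assms(2) subsetD[OF assms(6) point_mass_in_group_alg] in auto)
    then show ?thesis
      by (subst kk_dist_commute)
  qed
qed

theorem proposition6p19:
  fixes G :: "('a, 'b) monoid_scheme" and H K :: "'a set"
  assumes "group G" and "subgroup H G" and "subgroup K G" and "H \<noteq> K"
  shows "kk_dist (l1_norm G) (group_alg H) (group_alg K) = kk_dist (l1_norm G) (l1 H) (l1 K)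
    \<and> kk_dist (l1_norm G) (l1 H) (l1 K) = 1"
proof -
  have "H \<subseteq> carrier G" "K \<subseteq> carrier G"
    using assms(2,3) by (simp_all add: subgroup.subset)
  note dist = kk_dist_eq_1[OF this assms(4)]
  \<comment> \<open>The two claims are the smallest and the largest choice in the sandwich.\<close>
  have "kk_dist (l1_norm G) (group_alg H) (group_alg K) = 1"
    by (rule dist) (simp_all add: group_alg_subset_l1)
  moreover have "kk_dist (l1_norm G) (l1 H) (l1 K) = 1"
    by (rule dist) (simp_all add: group_alg_subset_l1)
  ultimately show ?thesis
    by simp
qed

end
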